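(* If $A$ is a formula derivable in the deep inference system $\mathsf{MLL}_{DI}$, then $$\big(n^-_{\otimes}(A)+n^+_{\wp}(A)\big)-\big(n^+_{\otimes}(A)+n^-_{\wp}(A)\big)=1.$$
   Context: $\wp$ denotes par and $\otimes$ tensor. Formulae are built from atoms $\alpha_i$ and negated atoms $\overline{\alpha_i}$ using $\otimes$ and $\wp$; negation of a compound formula is defined by $\overline{A\otimes B}=\overline{A}\wp\overline{B}$, $\overline{A\wp B}=\overline{A}\otimes\overline{B}$, $\overline{\overline{\alpha}}=\alpha$. Formulae are not identified up to associativity or commutativity. A context $S\{\ \}$ is a formula with one hole; $S\{B\}$ denotes the result of filling the hole with $B$. The system $\mathsf{MLL}_{DI}$ has the axiom $\mathsf{i}{\downarrow}$ with conclusion $\overline{A}\wp A$ (no premise), and the following rules, each rewriting a premise $S\{P\}$ into a conclusion $S\{Q\}$ for an arbitrary context $S$: $\mathsf{i}{\downarrow}$: $S\{B\}\to S\{B\otimes(\overline{A}\wp A)\}$; $\mathsf{i}{\uparrow}$: $S\{(A\otimes\overline{A})\wp B\}\to S\{B\}$; $\sigma{\uparrow}$: $S\{A\wp B\}\to S\{B\wp A\}$; $\sigma{\downarrow}$: $S\{A\otimes B\}\to S\{B\otimes A\}$; $\alpha{\uparrow}$: $S\{A\wp(B\wp C)\}\to S\{(A\wp B)\wp C\}$; $\alpha{\downarrow}$: $S\{(A\otimes B)\otimes C\}\to S\{A\otimes(B\otimes C)\}$; switch $\mathsf{s}$: $S\{A\otimes(B\wp C)\}\to S\{(A\otimes B)\wp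 C\}$. A formula is derivable if it is the last formula of a finite sequence starting with an axiom instance in which each subsequent formula is obtained from the previous one by a rule. In the counting, a connective occurrence occurs positively if the number of negation overlines above it is even, negatively otherwise (formulas may be read as expressions with overlines, equivalent up to the DeMorgan laws); $n^{\pm}_{\otimes}(A)$, $n^{\pm}_{\wp}(A)$ count positive/negative occurrences of $\otimes$, $\wp$ in $A$. *)

theory Defs
  imports Main
begin

datatype 'a formula =
    Atom 'a
  | NAtom 'a
  | Tensor "'a formula" "'a formula"  (infixr "\<otimes>" 75)
  | Par "'a formula" "'a formula"  (infixr "\<wp>" 70)

primrec neg :: "'a formula \<Rightarrow> 'a formula" where
  "neg (Atom a) = NAtom a"
| "neg (NAtom a) = Atom a"
| "neg (A \<otimes> B) = neg A \<wp> neg B"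
| "neg (A \<wp> B) = neg A \<otimes> neg B"

datatype 'a ctxt =
    Hole
  | CTensorL "'a ctxt" "'a formula"
  | CTensorR "'a formula" "'a ctxt"
  | CParL "'a ctxt" "'a formula"
  | CParR "'a formula" "'a ctxt"

primrec fill :: "'a ctxt \<Rightarrow> 'a formula \<Rightarrow> 'a formula" where
  "fill Hole P = P"
| "fill (CTensorL S B) P = fill S P \<otimes> B"
| "fill (CTensorR B S) P = B \<otimes> fill S P"
| "fill (CParL S B) P = fill S P \<wp> B"
| "fill (CParR B S) P = B \<wp> fill S P"

inductive rule :: "'a formula \<Rightarrow> 'a formula \<Rightarrow> bool" where
  i_down: "rule B (B \<otimes> (neg A \<wp> A))"
| i_up: "rule ((A \<otimes> neg A) \<wp> B) B"
| sigma_up: "rule (A \<wp> B) (B \<wp> A)"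
| sigma_down: "rule (A \<otimes> B) (B \<otimes> A)"
| alpha_up: "rule (A \<wp> (B \<wp> C)) ((A \<wp> B) \<wp> C)"
| alpha_down: "rule ((A \<otimes> B) \<otimes> C) (A \<otimes> (B \<otimes> C))"
| switch: "rule (A \<otimes> (B \<wp> C)) ((A \<otimes> B) \<wp> C)"

inductive derivable :: "'a formula \<Rightarrow> bool" where
  ax: "derivable (neg A \<wp> A)"
| step: "derivable (fill S P) \<Longrightarrow> rule P Q \<Longrightarrow> derivable (fill S Q)"

text \<open>
  Expressions in which overlines may occur above compound subexpressions. Polarity is a property
  of such a written form of a formula; the formula itself is obtained by evaluating every overline
  with the De Morgan definition of negation.
\<close>

datatype 'a expr =
    EAtom 'a
  | ENeg "'a expr"
  | ETensor "'a expr" "'a expr"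
  | EPar "'a expr" "'a expr"

primrec formula_of :: "'a expr \<Rightarrow> 'a formula" where
  "formula_of (EAtom a) = Atom a"
| "formula_of (ENeg E) = neg (formula_of E)"
| "formula_of (ETensor E F) = formula_of E \<otimes> formula_of F"
| "formula_of (EPar E F) = formula_of E \<wp> formula_of F"

text \<open>
  The Boolean argument is the polarity being counted: \<open>True\<close> for occurrences below an even number
  of overlines, \<open>False\<close> for those below an odd number.
\<close>

primrec num_tensor :: "bool \<Rightarrow> 'a expr \<Rightarrow> nat" where
  "num_tensor p (EAtom a) = 0"
| "num_tensor p (ENeg E) = num_tensor (\<not> p) E"
| "num_tensor p (ETensor E F) = (if p then 1 else 0) + num_tensor p E + num_tensor p F"
| "num_tensor p (EPar E F) = num_tensor p E + num_tensor p F"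

primrec num_par :: "bool \<Rightarrow> 'a expr \<Rightarrow> nat" where
  "num_par p (EAtom a) = 0"
| "num_par p (ENeg E) = num_par (\<not> p) E"
| "num_par p (ETensor E F) = num_par p E + num_par p F"
| "num_par p (EPar E F) = (if p then 1 else 0) + num_par p E + num_par p F"

text \<open>A formula is itself such an expression, with overlines on atoms only.\<close>

primrec expr_of :: "'a formula \<Rightarrow> 'a expr" where
  "expr_of (Atom a) = EAtom a"
| "expr_of (NAtom a) = ENeg (EAtom a)"
| "expr_of (A \<otimes> B) = ETensor (expr_of A) (expr_of B)"
| "expr_of (A \<wp> B) = EPar (expr_of A) (expr_of B)"

lemma formula_of_expr_of: "formula_of (expr_of A) = A"
  by (induction A) simp_all

end

theory Submission
  imports Defs
begin

text \<open>
  Weigh every par by \<open>+1\<close> and every tensor by \<open>-1\<close>. De Morgan negation reverses the sign of the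
  weight of a formula, so \<open>neg A \<wp> A\<close> has weight \<open>1\<close> and \<open>A \<otimes> neg A\<close> has weight \<open>-1\<close>; the
  connective that attaches them in \<open>i_down\<close> and \<open>i_up\<close> compensates exactly. The other rules only
  rearrange connectives, so derivations preserve the weight \<open>1\<close> of the axiom. An overline also
  exchanges positive and negative occurrences, so the signed count of an expression is the weight
  of the formula it denotes, however the overlines are placed.
\<close>

primrec weight :: "'a formula \<Rightarrow> int" where
  "weight (Atom a) = 0"
| "weight (NAtom a) = 0"
| "weight (A \<otimes> B) = weight A + weight B - 1"
| "weight (A \<wp> B) = weight A + weight B + 1"

lemma weight_neg [simp]: "weight (neg A) = - weight A"
  by (induction A) simp_all

lemma weight_fill_diff: "weight (fill S P) - weight (fill S Q) = weight P - weight Q"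
  by (induction S) simp_all

lemma weight_eq_if_rule: "rule P Q \<Longrightarrow> weight P = weight Q"
  by (induction rule: rule.induct) simp_all

lemma weight_eq_1_if_derivable: "derivable A \<Longrightarrow> weight A = 1"
proof (induction rule: derivable.induct)
  case (ax A)
  show ?case by simp
next
  case (step S P Q)
  have "weight (fill S Q) = weight (fill S P)"
    using weight_fill_diff[of S P Q] weight_eq_if_rule[OF \<open>rule P Q\<close>] by simp
  also have "\<dots> = 1"
    by (fact step.IH)
  finally show ?case .
qed

definition polarity_balance :: "'a expr \<Rightarrow> int" where
  "polarity_balance E =
     (int (num_tensor False E) + int (num_par True E))
       - (int (num_tensor True E) + int (num_par False E))"

lemma polarity_balance_eq_weight: "polarity_balance E = weight (formula_of E)"
  by (induction E) (simp_all add: polarity_balance_def)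

theorem theorem3p4:
  fixes A :: "'a formula" and E :: "'a expr"
  assumes "derivable A"
    and "formula_of E = A"
  shows "(int (num_tensor False E) + int (num_par True E))
           - (int (num_tensor True E) + int (num_par False E)) = 1"
proof -
  have "polarity_balance E = weight A"
    using polarity_balance_eq_weight[of E] \<open>formula_of E = A\<close> by simp
  also have "\<dots> = 1"
    using \<open>derivable A\<close> by (rule weight_eq_1_if_derivable)
  finally show ?thesis
    unfolding polarity_balance_def .
qed

end
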